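(* Let $p,q\ge 1$, let $\Omega_1,\dots,\Omega_p$, $\Theta_1,\dots,\Theta_q$ and $S$ be nonempty closed convex subsets of $\mathbb{R}^n$, and let $\alpha_1,\dots,\alpha_p,\beta_1,\dots,\beta_q$ be positive real numbers. Put $f(x)=\sum_{i=1}^p\alpha_i d(x;\Omega_i)-\sum_{j=1}^q\beta_j d(x;\Theta_j)$. The problem $$\min\{f(x)\;|\;x\in S\}$$ has a solution (i.e., there is $\bar x\in S$ with $f(\bar x)\le f(x)$ for all $x\in S$) if at least one of the following conditions is satisfied: (i) $S$ is bounded; (ii) $\sum_{i=1}^p\alpha_i>\sum_{j=1}^q\beta_j$, and all the sets $\Omega_i$, $i=1,\dots,p$, are bounded.
   Context: $\mathbb{R}^n$ carries the Euclidean norm $\|\cdot\|$. For a nonempty closed convex set $Q\subset\mathbb{R}^n$, the distance function is $d(x;Q)=\inf\{\|x-w\|\;|\;w\in Q\}$. *)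

theory Defs
  imports "HOL-Analysis.Analysis"
begin

definition weighted_dist_diff ::
  "nat \<Rightarrow> (nat \<Rightarrow> real) \<Rightarrow> (nat \<Rightarrow> (real ^ 'n) set) \<Rightarrow>
   nat \<Rightarrow> (nat \<Rightarrow> real) \<Rightarrow> (nat \<Rightarrow> (real ^ 'n) set) \<Rightarrow> real ^ 'n \<Rightarrow> real"
  where "weighted_dist_diff p \<alpha> \<Omega> q \<beta> \<Theta> x =
    (\<Sum>i=1..p. \<alpha> i * infdist x (\<Omega> i)) - (\<Sum>j=1..q. \<beta> j * infdist x (\<Theta> j))"

end

theory Submission
  imports Defs
begin

text \<open>
  The objective is continuous, so a minimiser on \<open>S\<close> exists as soon as the search can be confined
  to a compact part of \<open>S\<close>. If \<open>S\<close> is bounded it is itself compact. Otherwise, far from the origin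
  the distance to a bounded set is \<open>norm x\<close> up to an additive constant, and the distance to any
  nonempty set is at most \<open>norm x\<close> plus a constant. Hence the objective is at least
  \<open>((\<Sum>i=1..p. \<alpha> i) - (\<Sum>j=1..q. \<beta> j)) * norm x - C\<close> for some \<open>C\<close>
  (\<open>weighted_dist_diff_lower_bound\<close>). The slope is positive, so the objective is coercive, and a
  continuous coercive function attains its minimum on a closed set
  (\<open>continuous_coercive_attains_inf\<close>).
\<close>

lemma infdist_ge_norm_minus:
  fixes x :: "'a::real_normed_vector"
  assumes "A \<noteq> {}" and "\<And>a. a \<in> A \<Longrightarrow> norm a \<le> M"
  shows "norm x - M \<le> infdist x A"
proof -
  have "norm x - M \<le> dist x a" if "a \<in> A" for a
    using assms(2)[OF that] norm_triangle_ineq2[of x a] by (simp add: dist_norm)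
  then show ?thesis
    unfolding infdist_notempty[OF assms(1)] by (intro cINF_greatest assms(1))
qed

lemma infdist_le_norm_plus:
  fixes x :: "'a::real_normed_vector"
  assumes "a \<in> A"
  shows "infdist x A \<le> norm x + norm a"
  using infdist_le[OF assms, of x] norm_triangle_ineq4[of x a] by (simp add: dist_norm)

text \<open>
  Any point \<open>x0\<close> of \<open>S\<close> serves as a competitor: by coercivity, points with value at most \<open>g x0\<close>
  lie in one fixed ball, and the part of \<open>S\<close> in that ball is compact.
\<close>

lemma continuous_coercive_attains_inf:
  fixes g :: "'a::{real_normed_vector, heine_borel} \<Rightarrow> real"
  assumes "S \<noteq> {}" and "closed S" and cont: "continuous_on S g" and "c > 0"
    and lower: "\<And>x. x \<in> S \<Longrightarrow> c * norm x - C \<le> g x"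
  shows "\<exists>y\<in>S. \<forall>x\<in>S. g y \<le> g x"
proof -
  obtain x0 where x0: "x0 \<in> S" using \<open>S \<noteq> {}\<close> by blast
  define K where "K = S \<inter> cball 0 ((g x0 + C) / c)"
  have in_K: "x \<in> K" if "x \<in> S" "g x \<le> g x0" for x
    using lower[OF that(1)] that \<open>c > 0\<close>
    by (simp add: K_def pos_le_divide_eq mult.commute)
  have "compact K"
    unfolding K_def using \<open>closed S\<close> by (intro closed_Int_compact compact_cball)
  moreover have "x0 \<in> K" using in_K x0 by simp
  moreover have "continuous_on K g"
    using cont by (rule continuous_on_subset) (simp add: K_def)
  ultimately obtain y where y: "y \<in> K" "\<forall>x\<in>K. g y \<le> g x"
    using continuous_attains_inf[of K g] by blast
  have "g y \<le> g x" if "x \<in> S" for x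
  proof (cases "g x \<le> g x0")
    case True
    then show ?thesis using in_K that y by blast
  next
    case False
    then show ?thesis using y \<open>x0 \<in> K\<close> by fastforce
  qed
  then show ?thesis using y by (auto simp: K_def)
qed

lemma continuous_on_weighted_dist_diff:
  "continuous_on S (weighted_dist_diff p \<alpha> \<Omega> q \<beta> \<Theta>)"
  unfolding weighted_dist_diff_def by (intro continuous_intros)

text \<open>
  Each added distance is bounded below through a bound \<open>M i\<close> for the norms of the points of \<open>\<Omega> i\<close>,
  each subtracted one is bounded above through a single point \<open>t j\<close> of \<open>\<Theta> j\<close>; the weighted sums of
  the \<open>M i\<close> and the \<open>norm (t j)\<close> make up the constant.
\<close>

lemma weighted_dist_diff_lower_bound:
  fixes \<Omega> \<Theta> :: "nat \<Rightarrow> (real ^ 'n) set"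
  assumes \<Omega>: "\<And>i. i \<in> {1..p} \<Longrightarrow> \<Omega> i \<noteq> {} \<and> bounded (\<Omega> i)"
    and \<Theta>: "\<And>j. j \<in> {1..q} \<Longrightarrow> \<Theta> j \<noteq> {}"
    and \<alpha>: "\<And>i. i \<in> {1..p} \<Longrightarrow> \<alpha> i \<ge> 0"
    and \<beta>: "\<And>j. j \<in> {1..q} \<Longrightarrow> \<beta> j \<ge> 0"
  shows "\<exists>C. \<forall>x. ((\<Sum>i=1..p. \<alpha> i) - (\<Sum>j=1..q. \<beta> j)) * norm x - C
    \<le> weighted_dist_diff p \<alpha> \<Omega> q \<beta> \<Theta> x"
proof -
  have "\<forall>i\<in>{1..p}. \<exists>M. \<forall>a\<in>\<Omega> i. norm a \<le> M"
    using \<Omega> by (auto simp: bounded_iff)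
  then obtain M where M: "\<And>i a. i \<in> {1..p} \<Longrightarrow> a \<in> \<Omega> i \<Longrightarrow> norm a \<le> M i"
    by metis
  obtain t where t: "\<And>j. j \<in> {1..q} \<Longrightarrow> t j \<in> \<Theta> j"
    using \<Theta> that[of "\<lambda>j. SOME a. a \<in> \<Theta> j"] by (simp add: some_in_eq)
  define C where "C = (\<Sum>i=1..p. \<alpha> i * M i) + (\<Sum>j=1..q. \<beta> j * norm (t j))"
  have "((\<Sum>i=1..p. \<alpha> i) - (\<Sum>j=1..q. \<beta> j)) * norm x - C
      \<le> weighted_dist_diff p \<alpha> \<Omega> q \<beta> \<Theta> x" for x
  proof -
    have "(\<Sum>i=1..p. \<alpha> i * (norm x - M i)) \<le> (\<Sum>i=1..p. \<alpha> i * infdist x (\<Omega> i))"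
      using \<Omega> \<alpha> M by (intro sum_mono mult_left_mono infdist_ge_norm_minus) auto
    moreover have "(\<Sum>j=1..q. \<beta> j * infdist x (\<Theta> j)) \<le> (\<Sum>j=1..q. \<beta> j * (norm x + norm (t j)))"
      using \<beta> t by (intro sum_mono mult_left_mono infdist_le_norm_plus) auto
    ultimately show ?thesis
      by (simp add: weighted_dist_diff_def C_def algebra_simps sum.distrib sum_subtractf
          sum_distrib_left)
  qed
  then show ?thesis by blast
qed

theorem theorem3p1:
  fixes p q :: nat
    and \<Omega> \<Theta> :: "nat \<Rightarrow> (real ^ 'n) set"
    and S :: "(real ^ 'n) set"
    and \<alpha> \<beta> :: "nat \<Rightarrow> real"
  assumes "p \<ge> 1" and "q \<ge> 1"
    and "\<And>i. i \<in> {1..p} \<Longrightarrow> \<Omega> i \<noteq> {} \<and> closed (\<Omega> i) \<and> convex (\<Omega> i)"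
    and "\<And>j. j \<in> {1..q} \<Longrightarrow> \<Theta> j \<noteq> {} \<and> closed (\<Theta> j) \<and> convex (\<Theta> j)"
    and "S \<noteq> {}" and "closed S" and "convex S"
    and "\<And>i. i \<in> {1..p} \<Longrightarrow> \<alpha> i > 0"
    and "\<And>j. j \<in> {1..q} \<Longrightarrow> \<beta> j > 0"
    and "bounded S \<or>
      ((\<Sum>i=1..p. \<alpha> i) > (\<Sum>j=1..q. \<beta> j) \<and> (\<forall>i\<in>{1..p}. bounded (\<Omega> i)))"
  shows "\<exists>xbar\<in>S. \<forall>x\<in>S.
    weighted_dist_diff p \<alpha> \<Omega> q \<beta> \<Theta> xbar \<le> weighted_dist_diff p \<alpha> \<Omega> q \<beta> \<Theta> x"
proof -
  let ?f = "weighted_dist_diff p \<alpha> \<Omega> q \<beta> \<Theta>"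
  from assms(10) show ?thesis
  proof
    assume "bounded S"
    then have "compact S" using \<open>closed S\<close> by (simp add: compact_eq_bounded_closed)
    then show ?thesis
      using \<open>S \<noteq> {}\<close> continuous_on_weighted_dist_diff by (rule continuous_attains_inf)
  next
    assume *: "(\<Sum>i=1..p. \<alpha> i) > (\<Sum>j=1..q. \<beta> j) \<and> (\<forall>i\<in>{1..p}. bounded (\<Omega> i))"
    have "\<exists>C. \<forall>x. ((\<Sum>i=1..p. \<alpha> i) - (\<Sum>j=1..q. \<beta> j)) * norm x - C \<le> ?f x"
      using * assms(3,4,8,9) by (intro weighted_dist_diff_lower_bound) (auto intro: less_imp_le)
    then obtain C where
      "\<And>x. ((\<Sum>i=1..p. \<alpha> i) - (\<Sum>j=1..q. \<beta> j)) * norm x - C \<le> ?f x"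
      by blast
    moreover have "(\<Sum>i=1..p. \<alpha> i) - (\<Sum>j=1..q. \<beta> j) > 0" using * by simp
    ultimately show ?thesis
      using \<open>S \<noteq> {}\<close> \<open>closed S\<close> continuous_on_weighted_dist_diff
      by (intro continuous_coercive_attains_inf)
  qed
qed

end
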